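(* The path system consisting of all geodesic segments in a median geodesic metric space is navigable.
   Context: A metric space $X$ is median if for all $x,y,z\in X$ there is a unique point $m$ with $d(u,m)+d(m,v)=d(u,v)$ for every pair $u,v\in\{x,y,z\}$. Let $\mathcal P$ be the set of all geodesic segments of $X$ (including trivial ones). An $(n,\mathcal P)$-polygonal line is a concatenation of at most $n$ geodesic segments; $\alpha^\pm$ denote endpoints and $\|p\|$ length. $\mathcal P$ is navigable if there are $C\ge1$ and an integer $k\ge1$ such that for every $R\ge C$, $m\in X$, $n$, and $(n,\mathcal P)$-polygonal line $\alpha$ with $d(\alpha,m)\ge R$ and $d(\alpha^\pm,m)\le2R$, there is a $(kn,\mathcal P)$-polygonal line $p$ with the same endpoints as $\alpha$, $\|p\|\le CnR$, avoiding the closed ball $B(m,R/C)$. *)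

theory Defs
  imports "HOL-Analysis.Analysis"
begin

text \<open>
  The three conditions range over pairs of positions in the triple, not over pairs of elements of
  the set of its entries: when two entries coincide, the median is that entry.
\<close>

definition median_space :: "'a::metric_space itself \<Rightarrow> bool" where
  "median_space TYPE('a) \<longleftrightarrow>
     (\<forall>x y z :: 'a. \<exists>!m.
        dist x m + dist m y = dist x y \<and>
        dist y m + dist m z = dist y z \<and>
        dist x m + dist m z = dist x z)"

text \<open>
  Paths are parametrised by the unit interval, as in the library, so an isometric embedding of
  \<open>{0..L}\<close> is represented by its linear reparametrisation, with \<open>L\<close> the distance between the
  endpoints.  The case \<open>L = 0\<close> gives the trivial segments.
\<close>

definition geodesic_segments :: "(real \<Rightarrow> 'a::metric_space) set" where
  "geodesic_segments =
     {g. \<forall>s\<in>{0..1}. \<forall>t\<in>{0..1}.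
           dist (g s) (g t) = \<bar>s - t\<bar> * dist (pathstart g) (pathfinish g)}"

definition geodesic_space :: "'a::metric_space itself \<Rightarrow> bool" where
  "geodesic_space TYPE('a) \<longleftrightarrow>
     (\<forall>x y :: 'a. \<exists>g\<in>geodesic_segments. pathstart g = x \<and> pathfinish g = y)"

inductive concatenation ::
  "(real \<Rightarrow> 'a::topological_space) set \<Rightarrow> nat \<Rightarrow> (real \<Rightarrow> 'a) \<Rightarrow> bool" for P where
  single: "g \<in> P \<Longrightarrow> concatenation P 1 g"
| join: "concatenation P n p \<Longrightarrow> g \<in> P \<Longrightarrow> pathfinish p = pathstart g \<Longrightarrow>
           concatenation P (Suc n) (p +++ g)"

definition polygonal_line ::
  "nat \<Rightarrow> (real \<Rightarrow> 'a::topological_space) set \<Rightarrow> (real \<Rightarrow> 'a) \<Rightarrow> bool" where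
  "polygonal_line n P p \<longleftrightarrow> (\<exists>j\<le>n. concatenation P j p)"

definition path_length :: "(real \<Rightarrow> 'a::metric_space) \<Rightarrow> ereal" where
  "path_length p =
     (SUP ts \<in> {ts. sorted ts \<and> set ts \<subseteq> {0..1}}.
        ereal (\<Sum>i<length ts - 1. dist (p (ts ! i)) (p (ts ! Suc i))))"

definition navigable :: "(real \<Rightarrow> 'a::metric_space) set \<Rightarrow> bool" where
  "navigable P \<longleftrightarrow>
     (\<exists>(C::real) (k::nat). C \<ge> 1 \<and> k \<ge> 1 \<and>
       (\<forall>R\<ge>C. \<forall>m n \<alpha>.
          polygonal_line n P \<alpha> \<longrightarrow>
          infdist m (path_image \<alpha>) \<ge> R \<longrightarrow>
          dist (pathstart \<alpha>) m \<le> 2 * R \<longrightarrow>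
          dist (pathfinish \<alpha>) m \<le> 2 * R \<longrightarrow>
          (\<exists>p. polygonal_line (k * n) P p \<and>
               pathstart p = pathstart \<alpha> \<and> pathfinish p = pathfinish \<alpha> \<and>
               path_length p \<le> ereal (C * real n * R) \<and>
               path_image p \<inter> cball m (R / C) = {})))"

end

theory Submission
  imports Defs
begin

text \<open>
  Call a pair \<open>u, v\<close> radial if \<open>v\<close> lies between \<open>m\<close> and \<open>u\<close>.  Along a side of the polygonal line,
  from \<open>x\<close> to \<open>y\<close>, the distances from \<open>m\<close> to the medians \<open>a\<close> of \<open>x, p, m\<close> and \<open>b\<close> of \<open>p, y, m\<close>
  are Gromov products, and since \<open>p\<close> lies between \<open>x\<close> and \<open>y\<close> they add up to at least
  \<open>d(m, p) \<ge> R\<close>.  By the intermediate value theorem some \<open>p\<close> makes both at least \<open>R/2\<close>, and the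
  radial pairs \<open>x, a\<close>, \<open>p, a\<close>, \<open>p, b\<close>, \<open>y, b\<close> replace the side.  Next push every vertex towards
  \<open>m\<close> onto the sphere of radius \<open>R/2\<close>.  If \<open>u, v\<close> is radial, the images \<open>u', v'\<close> both lie between
  \<open>m\<close> and \<open>u\<close>, so the median \<open>w\<close> of \<open>u, u', v'\<close> is further out than both: the geodesics from \<open>u'\<close>
  to \<open>w\<close> and from \<open>w\<close> to \<open>v'\<close> have length at most \<open>R\<close> and stay outside the ball of radius
  \<open>R/2\<close>.  Each side thus becomes eight short geodesics, and two more join the endpoints to their
  images.
\<close>

section \<open>Metric intervals, medians and geodesics\<close>

definition metric_interval :: "'a::metric_space \<Rightarrow> 'a \<Rightarrow> 'a set" where
  "metric_interval x y = {z. dist x z + dist z y = dist x y}"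

lemma metric_interval_commute: "metric_interval x y = metric_interval y x"
  by (auto simp: metric_interval_def dist_commute algebra_simps)

lemma metric_interval_trans:
  assumes "v \<in> metric_interval m u" "z \<in> metric_interval m v"
  shows "z \<in> metric_interval m u"
  using assms dist_triangle[of m u z] dist_triangle[of z u v]
  by (simp add: metric_interval_def)

lemma metric_interval_between:
  assumes "v \<in> metric_interval m u" "w \<in> metric_interval v u"
  shows "v \<in> metric_interval m w"
  using assms dist_triangle[of m u w] dist_triangle[of m w v]
  by (simp add: metric_interval_def)

text \<open>By \<open>metric_interval_between\<close>, \<open>v\<close> lies between
  \<open>m\<close> and \<open>z\<close>; thus a radial geodesic comes no closer to \<open>m\<close>
  than its inner end.\<close>

lemma dist_le_of_radial:
  assumes "v \<in> metric_interval m u" "z \<in> metric_interval v u"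
  shows "dist m v \<le> dist m z"
  using metric_interval_between[OF assms] by (simp add: metric_interval_def)
    (metis add_increasing2 order_refl zero_le_dist)

lemma median_space_obtains:
  fixes x y z :: "'a::metric_space"
  assumes "median_space TYPE('a)"
  obtains w where "w \<in> metric_interval x y" "w \<in> metric_interval y z" "w \<in> metric_interval x z"
  using assms unfolding median_space_def metric_interval_def by blast

lemma geodesic_segment_image_subset:
  assumes "g \<in> geodesic_segments"
  shows "path_image g \<subseteq> metric_interval (pathstart g) (pathfinish g)"
proof
  fix z assume "z \<in> path_image g"
  then obtain t where t: "t \<in> {0..1}" "z = g t" by (auto simp: path_image_def)
  have "dist (g 0) (g t) = \<bar>0 - t\<bar> * dist (pathstart g) (pathfinish g)"
       "dist (g t) (g 1) = \<bar>t - 1\<bar> * dist (pathstart g) (pathfinish g)"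
    using assms t by (simp_all add: geodesic_segments_def)
  then show "z \<in> metric_interval (pathstart g) (pathfinish g)"
    using t by (simp add: metric_interval_def pathstart_def pathfinish_def algebra_simps)
qed

lemma geodesic_segment_continuous:
  assumes "g \<in> geodesic_segments"
  shows "continuous_on {0..1} g"
proof -
  have "(dist (pathstart g) (pathfinish g))-lipschitz_on {0..1} g"
    using assms by (intro lipschitz_onI)
      (auto simp: geodesic_segments_def dist_real_def mult.commute)
  then show ?thesis by (rule lipschitz_on_continuous_on)
qed

lemma geodesic_space_sphere_point:
  fixes m x :: "'a::metric_space"
  assumes "geodesic_space TYPE('a)" "0 \<le> r" "r \<le> dist m x"
  obtains z where "z \<in> metric_interval m x" "dist m z = r"
proof -
  obtain g where g: "g \<in> geodesic_segments" "pathstart g = m" "pathfinish g = x"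
    using assms(1) unfolding geodesic_space_def by blast
  have "continuous_on {0..1} (\<lambda>t. dist m (g t))"
    by (intro continuous_intros geodesic_segment_continuous g)
  moreover have "dist m (g 0) \<le> r" "r \<le> dist m (g 1)"
    using g assms by (auto simp: pathstart_def pathfinish_def)
  ultimately obtain t where t: "0 \<le> t" "t \<le> 1" "dist m (g t) = r"
    using IVT'[of "\<lambda>t. dist m (g t)" 0 r 1] by auto
  then have "g t \<in> path_image g" by (auto simp: path_image_def)
  then show ?thesis using that geodesic_segment_image_subset[OF g(1)] g t by blast
qed

subsection \<open>Length of concatenations\<close>

text \<open>
  A function \<open>\<phi>\<close> as below plays the role of arc length from the initial point.  It makes the
  additivity bound for joined paths independent of how a partition meets the junction.
\<close>

definition length_bound :: "(real \<Rightarrow> 'a::metric_space) \<Rightarrow> real \<Rightarrow> bool" where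
  "length_bound p L \<longleftrightarrow>
     (\<exists>\<phi>. (\<forall>s t. 0 \<le> s \<longrightarrow> s \<le> t \<longrightarrow> t \<le> 1 \<longrightarrow> dist (p s) (p t) \<le> \<phi> t - \<phi> s) \<and> \<phi> 1 - \<phi> 0 \<le> L)"

lemma length_bound_geodesic:
  assumes "g \<in> geodesic_segments" "dist (pathstart g) (pathfinish g) \<le> L"
  shows "length_bound g L"
  unfolding length_bound_def
proof (intro exI conjI allI impI)
  let ?d = "dist (pathstart g) (pathfinish g)"
  show "1 * ?d - 0 * ?d \<le> L" using assms by simp
  fix s t :: real assume "0 \<le> s" "s \<le> t" "t \<le> 1"
  moreover from this have "dist (g s) (g t) = \<bar>s - t\<bar> * ?d"
    using assms unfolding geodesic_segments_def by force
  ultimately show "dist (g s) (g t) \<le> t * ?d - s * ?d" by (simp add: algebra_simps)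
qed

lemma length_bound_join:
  assumes "length_bound p L" "length_bound q M" "pathfinish p = pathstart q"
  shows "length_bound (p +++ q) (L + M)"
proof -
  obtain \<phi> where \<phi>: "\<And>s t. 0 \<le> s \<Longrightarrow> s \<le> t \<Longrightarrow> t \<le> 1 \<Longrightarrow> dist (p s) (p t) \<le> \<phi> t - \<phi> s"
    and L: "\<phi> 1 - \<phi> 0 \<le> L" using assms(1) unfolding length_bound_def by blast
  obtain \<psi> where \<psi>: "\<And>s t. 0 \<le> s \<Longrightarrow> s \<le> t \<Longrightarrow> t \<le> 1 \<Longrightarrow> dist (q s) (q t) \<le> \<psi> t - \<psi> s"
    and M: "\<psi> 1 - \<psi> 0 \<le> M" using assms(2) unfolding length_bound_def by blast
  \<comment> \<open>The shift by \<open>\<phi> 1 - \<psi> 0\<close> makes the two halves agree at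
    the junction \<open>1/2\<close>.\<close>
  define \<tau> where "\<tau> t = (if t \<le> 1/2 then \<phi> (2 * t) else \<phi> 1 + \<psi> (2 * t - 1) - \<psi> 0)" for t :: real
  have pq: "p 1 = q 0" using assms(3) by (simp add: pathstart_def pathfinish_def)
  have "dist ((p +++ q) s) ((p +++ q) t) \<le> \<tau> t - \<tau> s" if "0 \<le> s" "s \<le> t" "t \<le> 1" for s t
  proof -
    consider "t \<le> 1/2" | "s \<le> 1/2" "1/2 < t" | "1/2 < s" by linarith
    then show ?thesis
    proof cases
      case 1 then show ?thesis using that \<phi>[of "2 * s" "2 * t"] by (simp add: joinpaths_def \<tau>_def)
    next
      case 2
      have "dist (p (2 * s)) (q (2 * t-1)) \<le> dist (p (2 * s)) (p 1) + dist (q 0) (q (2 * t-1))"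
        using dist_triangle[of "p (2 * s)" "q (2 * t-1)" "p 1"] pq by simp
      then show ?thesis using 2 that \<phi>[of "2 * s" 1] \<psi>[of 0 "2 * t-1"]
        by (simp add: joinpaths_def \<tau>_def)
    next
      case 3 then show ?thesis using that \<psi>[of "2 * s-1" "2 * t-1"] by (simp add: joinpaths_def \<tau>_def)
    qed
  qed
  moreover have "\<tau> 1 - \<tau> 0 \<le> L + M" using L M by (simp add: \<tau>_def)
  ultimately show ?thesis unfolding length_bound_def by blast
qed

lemma path_length_le:
  assumes "length_bound p L"
  shows "path_length p \<le> ereal L"
  unfolding path_length_def
proof (rule SUP_least, clarsimp)
  fix ts :: "real list" assume ts: "sorted ts" "set ts \<subseteq> {0..1}"
  obtain \<phi> where \<phi>: "\<And>s t. 0 \<le> s \<Longrightarrow> s \<le> t \<Longrightarrow> t \<le> 1 \<Longrightarrow> dist (p s) (p t) \<le> \<phi> t - \<phi> s"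
    and L: "\<phi> 1 - \<phi> 0 \<le> L" using assms unfolding length_bound_def by blast
  have mono: "\<phi> s \<le> \<phi> t" if "0 \<le> s" "s \<le> t" "t \<le> 1" for s t
    using \<phi>[OF that] zero_le_dist[of "p s" "p t"] by linarith
  have rng: "0 \<le> ts ! i \<and> ts ! i \<le> 1" if "i < length ts" for i
    using ts(2) nth_mem[OF that] by auto
  show "(\<Sum>i<length ts - Suc 0. dist (p (ts ! i)) (p (ts ! Suc i))) \<le> L"
  proof (cases "ts = []")
    \<comment> \<open>For \<open>[]\<close> the truncated subtraction gives \<open>0\<close>, so the
      empty sum only requires \<open>0 \<le> L\<close>.\<close>
    case True then show ?thesis using L mono[of 0 1] by simp
  next
    case False
    let ?n = "length ts - Suc 0"
    have "(\<Sum>i<?n. dist (p (ts ! i)) (p (ts ! Suc i))) \<le> (\<Sum>i<?n. \<phi> (ts ! Suc i) - \<phi> (ts ! i))"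
      using ts(1) rng by (intro sum_mono \<phi>) (auto simp: sorted_iff_nth_mono)
    also have "\<dots> = \<phi> (ts ! ?n) - \<phi> (ts ! 0)" by (rule sum_lessThan_telescope)
    also have "\<dots> \<le> \<phi> 1 - \<phi> 0"
      using False rng[of 0] rng[of ?n] by (intro diff_mono mono) auto
    finally show ?thesis using L by simp
  qed
qed

subsection \<open>Short steps avoiding a ball\<close>

text \<open>Quantifying over the whole interval makes every geodesic from \<open>u\<close> to
  \<open>v\<close> avoid the open ball of radius \<open>r\<close>, whichever one is chosen
  later.\<close>

definition avoiding_steps :: "'a::metric_space \<Rightarrow> real \<Rightarrow> real \<Rightarrow> ('a \<times> 'a) set" where
  "avoiding_steps m r D =
     {(u, v). dist u v \<le> D \<and> (\<forall>z\<in>metric_interval u v. r \<le> dist m z)}"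

lemma avoiding_steps_sym: "(u, v) \<in> avoiding_steps m r D \<Longrightarrow> (v, u) \<in> avoiding_steps m r D"
  by (simp add: avoiding_steps_def dist_commute metric_interval_commute)

lemma avoiding_steps_relpow_sym:
  "(u, v) \<in> avoiding_steps m r D ^^ n \<Longrightarrow> (v, u) \<in> avoiding_steps m r D ^^ n"
proof (induction n arbitrary: v)
  case (Suc n)
  then obtain w where "(u, w) \<in> avoiding_steps m r D ^^ n" "(w, v) \<in> avoiding_steps m r D" by auto
  then show ?case using Suc.IH avoiding_steps_sym relpow_Suc_I2 by metis
qed simp

text \<open>One geodesic realises each step. The exponent is \<open>Suc n\<close> because a
  concatenation has at least one piece.\<close>

lemma relpow_avoiding_steps_imp_concatenation:
  fixes u v :: "'a::metric_space"
  assumes "geodesic_space TYPE('a)" "(u, v) \<in> avoiding_steps m r D ^^ Suc n"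
  shows "\<exists>p. concatenation geodesic_segments (Suc n) p \<and> pathstart p = u \<and> pathfinish p = v \<and>
           length_bound p (real (Suc n) * D) \<and> (\<forall>z\<in>path_image p. r \<le> dist m z)"
  using assms(2)
proof (induction n arbitrary: v)
  case 0
  obtain g where g: "g \<in> geodesic_segments" "pathstart g = u" "pathfinish g = v"
    using assms(1) unfolding geodesic_space_def by blast
  then show ?case
    using 0 geodesic_segment_image_subset[OF g(1)] concatenation.single[OF g(1)]
    by (auto simp: avoiding_steps_def intro!: exI[of _ g] length_bound_geodesic)
next
  case (Suc n)
  obtain w where w: "(u, w) \<in> avoiding_steps m r D ^^ Suc n" "(w, v) \<in> avoiding_steps m r D"
    using Suc.prems by (rule relpow_Suc_E)
  obtain p where p: "concatenation geodesic_segments (Suc n) p" "pathstart p = u" "pathfinish p = w"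
    "length_bound p (real (Suc n) * D)" "\<forall>z\<in>path_image p. r \<le> dist m z"
    using Suc.IH[OF w(1)] by blast
  obtain g where g: "g \<in> geodesic_segments" "pathstart g = w" "pathfinish g = v"
    using assms(1) unfolding geodesic_space_def by blast
  have "length_bound (p +++ g) (real (Suc n) * D + D)"
    using w(2) p(3) g by (intro length_bound_join[OF p(4)] length_bound_geodesic)
      (auto simp: avoiding_steps_def)
  moreover have "\<forall>z\<in>path_image (p +++ g). r \<le> dist m z"
    using p g w(2) geodesic_segment_image_subset[OF g(1)]
    by (auto simp: path_image_join avoiding_steps_def)
  ultimately show ?case
    using concatenation.join[OF p(1) g(1)] p g
    by (intro exI[of _ "p +++ g"]) (auto simp: algebra_simps)
qed

subsection \<open>Pushing a polygonal line onto a sphere\<close>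

text \<open>The set of all positions to which \<open>x\<close> may be pushed; geodesics to \<open>m\<close> need not be unique.\<close>

definition shadow :: "'a::metric_space \<Rightarrow> real \<Rightarrow> 'a \<Rightarrow> 'a set" where
  "shadow m r x = {z \<in> metric_interval m x. dist m z = r}"

lemma shadow_trans: "v \<in> metric_interval m u \<Longrightarrow> v' \<in> shadow m r v \<Longrightarrow> v' \<in> shadow m r u"
  by (auto simp: shadow_def intro: metric_interval_trans)

lemma shadow_steps:
  fixes m u :: "'a::metric_space"
  assumes "median_space TYPE('a)" "u' \<in> shadow m r u" "v' \<in> shadow m r u" "2 * r \<le> D"
  shows "(u', v') \<in> avoiding_steps m r D ^^ 2"
proof -
  obtain w where w: "w \<in> metric_interval u' v'" "w \<in> metric_interval v' u" "w \<in> metric_interval u' u"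
    using median_space_obtains[OF assms(1), of u' v' u] by blast
  have "dist u' v' \<le> D" using assms dist_triangle3[of u' v' m] by (simp add: shadow_def)
  then have short: "dist u' w \<le> D" "dist w v' \<le> D"
    using w(1) zero_le_dist[of u' w] zero_le_dist[of w v']
    unfolding metric_interval_def mem_Collect_eq by linarith+
  \<comment> \<open>Here \<open>x\<close> stands for \<open>u'\<close> and \<open>v'\<close> in
    turn: \<open>z\<close> lies between \<open>x\<close> and \<open>u\<close>, hence is no closer to
    \<open>m\<close> than \<open>x\<close>.\<close>
  have "r \<le> dist m z" if "x \<in> shadow m r u" "w \<in> metric_interval x u" "z \<in> metric_interval x w" for x z
    using that dist_le_of_radial[of x m u z] metric_interval_trans[of w x u z] by (simp add: shadow_def)
  then have "(u', w) \<in> avoiding_steps m r D" "(v', w) \<in> avoiding_steps m r D"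
    using assms w short by (auto simp: avoiding_steps_def dist_commute)
  then have "(u', v') \<in> avoiding_steps m r D O avoiding_steps m r D"
    using avoiding_steps_sym by blast
  then show ?thesis by (simp add: numeral_2_eq_2)
qed

lemma segment_shadow_steps:
  fixes m :: "'a::metric_space"
  assumes X: "median_space TYPE('a)" "geodesic_space TYPE('a)"
    and g: "g \<in> geodesic_segments"
    and far: "\<And>z. z \<in> path_image g \<Longrightarrow> 2 * r \<le> dist m z"
    and "0 \<le> r" "2 * r \<le> D"
    and x': "x' \<in> shadow m r (pathstart g)" and y': "y' \<in> shadow m r (pathfinish g)"
  shows "(x', y') \<in> avoiding_steps m r D ^^ 8"
proof -
  let ?x = "pathstart g" and ?y = "pathfinish g"
  \<comment> \<open>Gromov products at \<open>m\<close>, equal to the distances from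
    \<open>m\<close> to the medians \<open>a\<close> and \<open>b\<close> below. As formulas in
    distances they are visibly continuous in \<open>p\<close>.\<close>
  define f where "f p = (dist m ?x + dist m p - dist ?x p) / 2" for p
  define h where "h p = (dist m p + dist m ?y - dist p ?y) / 2" for p
  \<comment> \<open>The sum is \<open>dist m p\<close> plus the Gromov product of \<open>?x\<close>
    and \<open>?y\<close>, which is nonnegative.\<close>
  have sum: "2 * r \<le> f p + h p" if "p \<in> path_image g" for p
    using far[OF that] geodesic_segment_image_subset[OF g] that dist_triangle3[of ?x ?y m]
    by (auto simp: f_def h_def metric_interval_def field_simps dist_commute)
  obtain p where p: "p \<in> path_image g" "r \<le> f p" "r \<le> h p"
  proof (cases "r \<le> f ?y")
    case True
    moreover have "r \<le> h ?y" using far[OF pathfinish_in_path_image] \<open>0 \<le> r\<close> by (simp add: h_def)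
    ultimately show ?thesis using that by blast
  next
    \<comment> \<open>Along \<open>g\<close>, \<open>f\<close> falls from at least \<open>r\<close>
      to below \<open>r\<close>; where it equals \<open>r\<close>, \<open>sum\<close> leaves at
      least \<open>r\<close> for \<open>h\<close>.\<close>
    case False
    moreover have "r \<le> f ?x" using far[OF pathstart_in_path_image] \<open>0 \<le> r\<close> by (simp add: f_def)
    moreover have "continuous_on {0..1} (\<lambda>t. f (g t))"
      unfolding f_def by (intro continuous_intros geodesic_segment_continuous g) simp
    ultimately obtain t where t: "0 \<le> t" "t \<le> 1" "f (g t) = r"
      using IVT2'[of "\<lambda>t. f (g t)" 1 r 0] by (auto simp: pathstart_def pathfinish_def)
    then have "g t \<in> path_image g" by (auto simp: path_image_def)
    then show ?thesis using that sum[of "g t"] t by auto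
  qed
  obtain a where a: "a \<in> metric_interval ?x p" "a \<in> metric_interval p m" "a \<in> metric_interval ?x m"
    using median_space_obtains[OF X(1)] by blast
  obtain b where b: "b \<in> metric_interval p ?y" "b \<in> metric_interval ?y m" "b \<in> metric_interval p m"
    using median_space_obtains[OF X(1)] by blast
  have "dist m a = f p" "dist m b = h p"
    using a b by (auto simp: metric_interval_def f_def h_def dist_commute)
  then have "r \<le> dist m a" "r \<le> dist m b" "r \<le> dist m p"
    using p far[OF p(1)] \<open>0 \<le> r\<close> by auto
  then obtain a' p' b' where
    sh: "a' \<in> shadow m r a" "p' \<in> shadow m r p" "b' \<in> shadow m r b"
    using geodesic_space_sphere_point[OF X(2) \<open>0 \<le> r\<close>] unfolding shadow_def mem_Collect_eq by metis
  let ?E = "avoiding_steps m r D"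
  note step = shadow_steps[OF X(1) _ _ \<open>2 * r \<le> D\<close>]
  \<comment> \<open>Each pair lies in one shadow: that of \<open>?x\<close>, \<open>p\<close>,
    \<open>p\<close> and \<open>?y\<close> respectively.\<close>
  have "(x', a') \<in> ?E ^^ 2" "(p', b') \<in> ?E ^^ 2" "(p', a') \<in> ?E ^^ 2" "(y', b') \<in> ?E ^^ 2"
    using a b by (auto intro!: step x' y' sh intro: shadow_trans sh
        simp: metric_interval_commute[of _ m])
  then have "(x', y') \<in> ?E ^^ (2 + 2 + 2 + 2)"
    unfolding relpow_add using avoiding_steps_relpow_sym by blast
  then show ?thesis by simp
qed

lemma concatenation_shadow_steps:
  fixes m :: "'a::metric_space"
  assumes X: "median_space TYPE('a)" "geodesic_space TYPE('a)"
    and "concatenation geodesic_segments n p"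
    and "\<And>z. z \<in> path_image p \<Longrightarrow> 2 * r \<le> dist m z"
    and r: "0 \<le> r" "2 * r \<le> D"
    and "x' \<in> shadow m r (pathstart p)" "y' \<in> shadow m r (pathfinish p)"
  shows "(x', y') \<in> avoiding_steps m r D ^^ (8 * n)"
  using assms(3,4,7,8)
proof (induction arbitrary: y' rule: concatenation.induct)
  case (single g)
  then show ?case using segment_shadow_steps[OF X single.hyps _ r] by simp
next
  case (join n p g)
  have img: "path_image (p +++ g) = path_image p \<union> path_image g"
    using join.hyps by (simp add: path_image_join)
  have "2 * r \<le> dist m (pathfinish p)" using join.prems(1) img by auto
  then have "r \<le> dist m (pathfinish p)" using r by linarith
  \<comment> \<open>A single pushed position \<open>q\<close> of the junction ends the chain for
    \<open>p\<close> and starts that for \<open>g\<close>.\<close>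
  then obtain q where q: "q \<in> shadow m r (pathfinish p)"
    using geodesic_space_sphere_point[OF X(2) r(1)] unfolding shadow_def by blast
  have "(x', q) \<in> avoiding_steps m r D ^^ (8 * n)"
    using join.prems img q by (intro join.IH) auto
  moreover have "(q, y') \<in> avoiding_steps m r D ^^ 8"
    using join.prems img q join.hyps by (intro segment_shadow_steps[OF X _ _ r]) auto
  ultimately have "(x', y') \<in> avoiding_steps m r D ^^ (8 * n + 8)"
    unfolding relpow_add by blast
  then show ?case by (simp add: add.commute)
qed

theorem proposition1p15:
  assumes "median_space TYPE('a::metric_space)"
    and "geodesic_space TYPE('a)"
  shows "navigable (geodesic_segments :: (real \<Rightarrow> 'a) set)"
  unfolding navigable_def
\<comment> \<open>For \<open>10\<close>: \<open>8 * j\<close> steps between shadows and one at each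
  end give \<open>8 * j + 2 \<le> 10 * n\<close>, as \<open>1 \<le> j \<le> n\<close>. For
  \<open>20\<close>: each step has length at most \<open>2 * R\<close>.\<close>
proof (rule exI[of _ 20], rule exI[of _ 10], intro conjI allI impI)
  fix R :: real and m :: 'a and n and \<alpha> :: "real \<Rightarrow> 'a"
  assume R: "20 \<le> R" and "polygonal_line n geodesic_segments \<alpha>"
    and inf: "R \<le> infdist m (path_image \<alpha>)"
    and ends: "dist (pathstart \<alpha>) m \<le> 2 * R" "dist (pathfinish \<alpha>) m \<le> 2 * R"
  then obtain j where j: "j \<le> n" "concatenation geodesic_segments j \<alpha>"
    by (auto simp: polygonal_line_def)
  have "1 \<le> j" using j(2) by (induction rule: concatenation.induct) auto
  \<comment> \<open>An endpoint may be \<open>2 * R\<close> away from \<open>m\<close>, so its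
    radial step can have length \<open>3 * R / 2\<close>, more than the \<open>R\<close> that
    suffices between shadows.\<close>
  let ?x = "pathstart \<alpha>" and ?y = "pathfinish \<alpha>" and ?E = "avoiding_steps m (R / 2) (2 * R)"
  have far: "2 * (R / 2) \<le> dist m z" if "z \<in> path_image \<alpha>" for z
    using inf infdist_le[OF that, of m] by simp
  have inward: "\<exists>z'\<in>shadow m (R / 2) z. (z, z') \<in> ?E"
    if z: "z \<in> path_image \<alpha>" "dist z m \<le> 2 * R" for z
  proof -
    obtain z' where z': "z' \<in> metric_interval m z" "dist m z' = R / 2"
      using geodesic_space_sphere_point[OF assms(2), of "R / 2" m z] far[OF z(1)] R by auto
    then have "dist z z' \<le> 2 * R" "\<forall>w\<in>metric_interval z z'. R / 2 \<le> dist m w"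
      using z R dist_le_of_radial[OF z'(1)]
      by (auto simp: metric_interval_def dist_commute algebra_simps)
    then show ?thesis using z' by (auto simp: shadow_def avoiding_steps_def)
  qed
  obtain x' y' where x': "x' \<in> shadow m (R / 2) ?x" "(?x, x') \<in> ?E"
    and y': "y' \<in> shadow m (R / 2) ?y" "(y', ?y) \<in> ?E"
    using inward[of ?x] inward[of ?y] ends avoiding_steps_sym by blast
  have "(x', y') \<in> ?E ^^ (8 * j)"
    using concatenation_shadow_steps[OF assms j(2) far _ _ x'(1) y'(1)] R by simp
  then have "(?x, ?y) \<in> ?E ^^ Suc (Suc (8 * j))"
    using x'(2) y'(2) relpow_Suc_I relpow_Suc_I2 by metis
  then obtain p where p: "concatenation geodesic_segments (Suc (Suc (8 * j))) p"
    "pathstart p = ?x" "pathfinish p = ?y"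
    "length_bound p (real (Suc (Suc (8 * j))) * (2 * R))" "\<forall>z\<in>path_image p. R / 2 \<le> dist m z"
    using relpow_avoiding_steps_imp_concatenation[OF assms(2)] by blast
  have le: "Suc (Suc (8 * j)) \<le> 10 * n" using j \<open>1 \<le> j\<close> by simp
  then have "real (Suc (Suc (8 * j))) * (2 * R) \<le> real (10 * n) * (2 * R)"
    using R by (intro mult_right_mono of_nat_mono) auto
  then have "path_length p \<le> ereal (20 * real n * R)"
    using path_length_le[OF p(4)] by (auto elim!: order_trans)
  moreover have "path_image p \<inter> cball m (R / 20) = {}" using p(5) R by force
  ultimately show "\<exists>p. polygonal_line (10 * n) geodesic_segments p \<and>
      pathstart p = ?x \<and> pathfinish p = ?y \<and>
      path_length p \<le> ereal (20 * real n * R) \<and> path_image p \<inter> cball m (R / 20) = {}"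
    using p le unfolding polygonal_line_def by blast
qed auto

end
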